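(* Let $\mathcal{Q}$ be a locally compact space endowed with a positive Radon measure $\mu$, and let $K$ be a densely defined (not necessarily symmetric) operator on $\mathsf{L}^2(\mathcal{Q},\mu)$, with adjoint $K^\ast$. Suppose $K$ has an eigenvalue $k_0\in\mathbb{C}$ with a corresponding eigenfunction that is real and nonnegative $\mu$-almost everywhere on $\mathcal{Q}$. Then for every $\varphi\in\mathsf{D}(K^\ast)$ such that $\varphi>0$, $$\inf_{\mathcal{Q}}\left[\frac{\Re(K^\ast\varphi)}{\varphi}\right]\leqslant \Re(k_0)\leqslant\sup_{\mathcal{Q}}\left[\frac{\Re(K^\ast\varphi)}{\varphi}\right]$$ and $$\inf_{\mathcal{Q}}\left[-\frac{\Im(K^\ast\varphi)}{\varphi}\right]\leqslant \Im(k_0)\leqslant\sup_{\mathcal{Q}}\left[-\frac{\Im(K^\ast\varphi)}{\varphi}\right].$$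
   Context: $\mathsf{L}^2(\mathcal{Q},\mu)$ is the Hilbert space of square-integrable complex functions with scalar product $\langle\psi|\varphi\rangle=\int_{\mathcal{Q}}\overline{\psi}\,\varphi\,d\mu$; $\mathsf{D}(K^\ast)$ is the domain of the adjoint. An eigenfunction is a nonzero element of $\mathsf{L}^2(\mathcal{Q},\mu)$. The condition $\varphi>0$ means that $\varphi$ is real and strictly positive on $\mathcal{Q}$; infima and suprema are taken over $q\in\mathcal{Q}$ for the pointwise quotients (with representatives of $\varphi$ and $K^\ast\varphi$ fixed) and may be infinite. *)

theory Defs
  imports "HOL-Analysis.Analysis"
begin

text \<open>A positive Radon measure on a topological space. The \<sigma>-algebra may be larger than the Borel
  one, so that the completion of a Radon measure is also covered. Compact sets are required to be
  measurable explicitly because compact sets need not be Borel in a non-Hausdorff space.\<close>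

definition radon_measure :: "'a topology \<Rightarrow> 'a measure \<Rightarrow> bool" where
  "radon_measure X M \<longleftrightarrow>
     space M = topspace X \<and>
     (\<forall>U. openin X U \<longrightarrow> U \<in> sets M) \<and>
     (\<forall>C. compactin X C \<longrightarrow> C \<in> sets M \<longrightarrow> emeasure M C < \<infinity>) \<and>
     (\<forall>A\<in>sets M. emeasure M A = (INF U\<in>{U. openin X U \<and> A \<subseteq> U}. emeasure M U)) \<and>
     (\<forall>U. openin X U \<longrightarrow>
        emeasure M U = (SUP C\<in>{C. compactin X C \<and> C \<in> sets M \<and> C \<subseteq> U}. emeasure M C))"

definition square_integrable :: "'a measure \<Rightarrow> ('a \<Rightarrow> complex) set" where
  "square_integrable M =
     {f \<in> borel_measurable M. integrable M (\<lambda>x. (cmod (f x))\<^sup>2)}"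

definition l2_rel :: "'a measure \<Rightarrow> (('a \<Rightarrow> complex) \<times> ('a \<Rightarrow> complex)) set" where
  "l2_rel M = {(f, g). f \<in> square_integrable M \<and> g \<in> square_integrable M \<and> (AE x in M. f x = g x)}"

text \<open>Elements of \<open>L2 M\<close> are genuine classes of functions modulo equality almost everywhere. The
  operations are independent of representatives; see the lemmas \<open>l2_add_class\<close>,
  \<open>l2_scale_class\<close> and \<open>l2_inner_class\<close> below. Note that \<open>l2_class M f\<close> is the empty set, and hence not in
  \<open>L2 M\<close>, if \<open>f\<close> is not square-integrable.\<close>

definition L2 :: "'a measure \<Rightarrow> ('a \<Rightarrow> complex) set set" where
  "L2 M = square_integrable M // l2_rel M"

definition l2_class :: "'a measure \<Rightarrow> ('a \<Rightarrow> complex) \<Rightarrow> ('a \<Rightarrow> complex) set" where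
  "l2_class M f = l2_rel M `` {f}"

definition l2_zero :: "'a measure \<Rightarrow> ('a \<Rightarrow> complex) set" where
  "l2_zero M = l2_class M (\<lambda>_. 0)"

definition l2_add ::
  "'a measure \<Rightarrow> ('a \<Rightarrow> complex) set \<Rightarrow> ('a \<Rightarrow> complex) set \<Rightarrow> ('a \<Rightarrow> complex) set" where
  "l2_add M F G = (\<Union>f\<in>F. \<Union>g\<in>G. l2_class M (\<lambda>x. f x + g x))"

definition l2_scale ::
  "'a measure \<Rightarrow> complex \<Rightarrow> ('a \<Rightarrow> complex) set \<Rightarrow> ('a \<Rightarrow> complex) set" where
  "l2_scale M c F = (\<Union>f\<in>F. l2_class M (\<lambda>x. c * f x))"

definition l2_inner ::
  "'a measure \<Rightarrow> ('a \<Rightarrow> complex) set \<Rightarrow> ('a \<Rightarrow> complex) set \<Rightarrow> complex" where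
  "l2_inner M F G = the_elem (\<Union>f\<in>F. \<Union>g\<in>G. {LINT x|M. cnj (f x) * g x})"

definition l2_norm :: "'a measure \<Rightarrow> ('a \<Rightarrow> complex) set \<Rightarrow> real" where
  "l2_norm M F = sqrt (Re (l2_inner M F F))"

text \<open>An operator on \<open>L2 M\<close> is a linear map \<open>K\<close> defined on a subspace \<open>D\<close>; the values of \<open>K\<close>
  outside \<open>D\<close> are irrelevant.\<close>

definition l2_operator ::
  "'a measure \<Rightarrow> ('a \<Rightarrow> complex) set set \<Rightarrow> (('a \<Rightarrow> complex) set \<Rightarrow> ('a \<Rightarrow> complex) set) \<Rightarrow> bool" where
  "l2_operator M D K \<longleftrightarrow>
     D \<subseteq> L2 M \<and> l2_zero M \<in> D \<and>
     (\<forall>F\<in>D. K F \<in> L2 M) \<and>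
     (\<forall>F\<in>D. \<forall>G\<in>D. l2_add M F G \<in> D \<and> K (l2_add M F G) = l2_add M (K F) (K G)) \<and>
     (\<forall>c. \<forall>F\<in>D. l2_scale M c F \<in> D \<and> K (l2_scale M c F) = l2_scale M c (K F))"

definition l2_dense :: "'a measure \<Rightarrow> ('a \<Rightarrow> complex) set set \<Rightarrow> bool" where
  "l2_dense M D \<longleftrightarrow>
     (\<forall>F\<in>L2 M. \<forall>e>0. \<exists>G\<in>D. l2_norm M (l2_add M F (l2_scale M (-1) G)) < e)"

definition adjoint_domain ::
  "'a measure \<Rightarrow> ('a \<Rightarrow> complex) set set \<Rightarrow> (('a \<Rightarrow> complex) set \<Rightarrow> ('a \<Rightarrow> complex) set)
     \<Rightarrow> ('a \<Rightarrow> complex) set set" where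
  "adjoint_domain M D K =
     {F \<in> L2 M. \<exists>H\<in>L2 M. \<forall>G\<in>D. l2_inner M F (K G) = l2_inner M H G}"

text \<open>For \<open>F\<close> in the domain of the adjoint, \<open>H\<close> is unique when \<open>D\<close> is dense.\<close>

definition adjoint_op ::
  "'a measure \<Rightarrow> ('a \<Rightarrow> complex) set set \<Rightarrow> (('a \<Rightarrow> complex) set \<Rightarrow> ('a \<Rightarrow> complex) set)
     \<Rightarrow> ('a \<Rightarrow> complex) set \<Rightarrow> ('a \<Rightarrow> complex) set" where
  "adjoint_op M D K F =
     (THE H. H \<in> L2 M \<and> (\<forall>G\<in>D. l2_inner M F (K G) = l2_inner M H G))"

definition l2_eigenvector ::
  "'a measure \<Rightarrow> ('a \<Rightarrow> complex) set set \<Rightarrow> (('a \<Rightarrow> complex) set \<Rightarrow> ('a \<Rightarrow> complex) set)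
     \<Rightarrow> complex \<Rightarrow> ('a \<Rightarrow> complex) set \<Rightarrow> bool" where
  "l2_eigenvector M D K k F \<longleftrightarrow> F \<in> D \<and> F \<noteq> l2_zero M \<and> K F = l2_scale M k F"

lemma equiv_l2_rel: "equiv (square_integrable M) (l2_rel M)"
proof (rule equivI)
  show "l2_rel M \<subseteq> square_integrable M \<times> square_integrable M"
    by (auto simp: l2_rel_def)
  show "refl_on (square_integrable M) (l2_rel M)"
    by (auto simp: refl_on_def l2_rel_def)
  show "sym (l2_rel M)"
    by (auto simp: sym_def l2_rel_def eq_commute)
  show "trans (l2_rel M)"
  proof (rule transI)
    fix f g h
    assume fg: "(f, g) \<in> l2_rel M" and gh: "(g, h) \<in> l2_rel M"
    have "AE x in M. f x = g x" "AE x in M. g x = h x"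
      using fg gh by (simp_all add: l2_rel_def)
    then have "AE x in M. f x = h x"
      by eventually_elim simp
    then show "(f, h) \<in> l2_rel M"
      using fg gh by (simp add: l2_rel_def)
  qed
qed

lemma mem_l2_class: "g \<in> l2_class M f \<longleftrightarrow>
    f \<in> square_integrable M \<and> g \<in> square_integrable M \<and> (AE x in M. f x = g x)"
  by (auto simp: l2_class_def l2_rel_def)

lemma l2_class_self: "f \<in> square_integrable M \<Longrightarrow> f \<in> l2_class M f"
  by (simp add: mem_l2_class)

lemma l2_class_eq:
  assumes "f \<in> square_integrable M" "g \<in> square_integrable M"
  shows "l2_class M f = l2_class M g \<longleftrightarrow> (AE x in M. f x = g x)"
  using eq_equiv_class_iff[OF equiv_l2_rel assms] assms
  by (simp add: l2_class_def l2_rel_def)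

lemma square_integrable_scale:
  "f \<in> square_integrable M \<Longrightarrow> (\<lambda>x. c * f x) \<in> square_integrable M"
  by (auto simp: square_integrable_def norm_mult power_mult_distrib)

lemma square_integrable_add:
  assumes "f \<in> square_integrable M" "g \<in> square_integrable M"
  shows "(\<lambda>x. f x + g x) \<in> square_integrable M"
proof -
  have [measurable]: "f \<in> borel_measurable M" "g \<in> borel_measurable M"
    using assms by (auto simp: square_integrable_def)
  have bound: "(cmod (f x + g x))\<^sup>2 \<le> 2 * (cmod (f x))\<^sup>2 + 2 * (cmod (g x))\<^sup>2" for x
  proof -
    have "(cmod (f x + g x))\<^sup>2 \<le> (cmod (f x) + cmod (g x))\<^sup>2"
      by (intro power_mono norm_triangle_ineq) auto
    also have "\<dots> \<le> 2 * (cmod (f x))\<^sup>2 + 2 * (cmod (g x))\<^sup>2"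
      using sum_squares_bound[of "cmod (f x)" "cmod (g x)"] by (simp add: power2_sum)
    finally show ?thesis .
  qed
  have "integrable M (\<lambda>x. 2 * (cmod (f x))\<^sup>2 + 2 * (cmod (g x))\<^sup>2)"
    using assms by (auto simp: square_integrable_def)
  then have "integrable M (\<lambda>x. (cmod (f x + g x))\<^sup>2)"
  proof (rule Bochner_Integration.integrable_bound)
    show "(\<lambda>x. (cmod (f x + g x))\<^sup>2) \<in> borel_measurable M"
      by measurable
    show "AE x in M. norm ((cmod (f x + g x))\<^sup>2) \<le> norm (2 * (cmod (f x))\<^sup>2 + 2 * (cmod (g x))\<^sup>2)"
      by (intro AE_I2) (simp add: bound)
  qed
  then show ?thesis by (auto simp: square_integrable_def)
qed

lemma integrable_square_integrable_mult:
  assumes "f \<in> square_integrable M" "g \<in> square_integrable M"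
  shows "integrable M (\<lambda>x. cnj (f x) * g x)"
proof -
  have [measurable]: "f \<in> borel_measurable M" "g \<in> borel_measurable M"
    using assms by (auto simp: square_integrable_def)
  have bound: "cmod (f x) * cmod (g x) \<le> (cmod (f x))\<^sup>2 + (cmod (g x))\<^sup>2" for x
  proof -
    have "0 \<le> cmod (f x) * cmod (g x)" by simp
    then show ?thesis
      using sum_squares_bound[of "cmod (f x)" "cmod (g x)"] by linarith
  qed
  have [measurable]: "cnj \<in> borel_measurable borel"
    by (rule borel_measurable_continuous_onI) (rule continuous_on_cnj[OF continuous_on_id])
  have "integrable M (\<lambda>x. (cmod (f x))\<^sup>2 + (cmod (g x))\<^sup>2)"
    using assms by (auto simp: square_integrable_def)
  then show ?thesis
  proof (rule Bochner_Integration.integrable_bound)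
    show "(\<lambda>x. cnj (f x) * g x) \<in> borel_measurable M"
      by measurable
    show "AE x in M. norm (cnj (f x) * g x) \<le> norm ((cmod (f x))\<^sup>2 + (cmod (g x))\<^sup>2)"
      by (intro AE_I2) (simp add: norm_mult bound)
  qed
qed

lemma l2_add_class:
  assumes "f \<in> square_integrable M" "g \<in> square_integrable M"
  shows "l2_add M (l2_class M f) (l2_class M g) = l2_class M (\<lambda>x. f x + g x)"
proof -
  have "l2_class M (\<lambda>x. f' x + g' x) = l2_class M (\<lambda>x. f x + g x)"
    if "f' \<in> l2_class M f" "g' \<in> l2_class M g" for f' g'
  proof -
    have sq: "f' \<in> square_integrable M" "g' \<in> square_integrable M"
      and "AE x in M. f x = f' x" "AE x in M. g x = g' x"
      using that by (simp_all add: mem_l2_class)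
    from this(3,4) have "AE x in M. f' x + g' x = f x + g x"
      by eventually_elim simp
    then show ?thesis
      using sq assms by (simp add: l2_class_eq square_integrable_add)
  qed
  then have "l2_add M (l2_class M f) (l2_class M g)
      = (\<Union>f'\<in>l2_class M f. \<Union>g'\<in>l2_class M g. l2_class M (\<lambda>x. f x + g x))"
    unfolding l2_add_def by (intro SUP_cong refl)
  moreover have "l2_class M f \<noteq> {}" "l2_class M g \<noteq> {}"
    using l2_class_self[OF assms(1)] l2_class_self[OF assms(2)] by blast+
  ultimately show ?thesis by simp
qed

lemma l2_scale_class:
  assumes "f \<in> square_integrable M"
  shows "l2_scale M c (l2_class M f) = l2_class M (\<lambda>x. c * f x)"
proof -
  have "l2_class M (\<lambda>x. c * f' x) = l2_class M (\<lambda>x. c * f x)"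
    if "f' \<in> l2_class M f" for f'
  proof -
    have sq: "f' \<in> square_integrable M" and "AE x in M. f x = f' x"
      using that by (simp_all add: mem_l2_class)
    from this(2) have "AE x in M. c * f' x = c * f x"
      by eventually_elim simp
    then show ?thesis
      using sq assms by (simp add: l2_class_eq square_integrable_scale)
  qed
  then have "l2_scale M c (l2_class M f) = (\<Union>f'\<in>l2_class M f. l2_class M (\<lambda>x. c * f x))"
    unfolding l2_scale_def by (intro SUP_cong refl)
  moreover have "l2_class M f \<noteq> {}"
    using l2_class_self[OF assms] by blast
  ultimately show ?thesis by simp
qed

lemma l2_inner_class:
  assumes "f \<in> square_integrable M" "g \<in> square_integrable M"
  shows "l2_inner M (l2_class M f) (l2_class M g) = (LINT x|M. cnj (f x) * g x)"
proof -
  have "(LINT x|M. cnj (f' x) * g' x) = (LINT x|M. cnj (f x) * g x)"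
    if "f' \<in> l2_class M f" "g' \<in> l2_class M g" for f' g'
  proof (rule integral_cong_AE)
    show "(\<lambda>x. cnj (f' x) * g' x) \<in> borel_measurable M" "(\<lambda>x. cnj (f x) * g x) \<in> borel_measurable M"
      using that assms
      by (simp_all add: mem_l2_class borel_measurable_integrable integrable_square_integrable_mult)
    show "AE x in M. cnj (f' x) * g' x = cnj (f x) * g x"
    proof -
      have "AE x in M. f x = f' x" "AE x in M. g x = g' x"
        using that by (simp_all add: mem_l2_class)
      then show ?thesis by eventually_elim simp
    qed
  qed
  then have "(\<Union>f'\<in>l2_class M f. \<Union>g'\<in>l2_class M g. {LINT x|M. cnj (f' x) * g' x})
      = (\<Union>f'\<in>l2_class M f. \<Union>g'\<in>l2_class M g. {LINT x|M. cnj (f x) * g x})"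
    by (intro SUP_cong refl) simp
  moreover have "l2_class M f \<noteq> {}" "l2_class M g \<noteq> {}"
    using l2_class_self[OF assms(1)] l2_class_self[OF assms(2)] by blast+
  ultimately show ?thesis by (simp add: l2_inner_def)
qed

end

theory Submission
  imports Defs
begin

text \<open>
  Let \<open>\<psi> \<ge> 0\<close> be the eigenfunction. Pairing \<open>\<phi>\<close> with \<open>K \<psi> = k0 \<psi>\<close> and moving \<open>K\<close> to the other
  side gives \<open>\<integral> cnj (K\<^sup>* \<phi>) \<psi> = k0 \<integral> \<phi> \<psi>\<close>. As \<open>\<phi>\<close> and \<open>\<psi>\<close> are real, the real and imaginary parts of
  this identity read \<open>\<integral> Re (K\<^sup>* \<phi>) \<psi> = Re k0 \<integral> \<phi> \<psi>\<close> and \<open>\<integral> - Im (K\<^sup>* \<phi>) \<psi> = Im k0 \<integral> \<phi> \<psi>\<close>. So each of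
  the two numbers is an average of the corresponding quotient against the weight \<open>\<phi> \<psi> \<ge> 0\<close>, which
  is not almost everywhere zero, and an average lies between infimum and supremum
  (\<open>weighted_average_between_INF_SUP\<close>).

  The identity presupposes that the definite description in \<open>adjoint_op\<close> denotes something.
  This is where density of the domain enters: an element of \<open>L2 M\<close> is determined by its scalar
  products with a dense set (\<open>dense_inner_eq_imp_AE_eq\<close>).
\<close>

section \<open>Representatives of classes\<close>

lemma L2_eq_class:
  assumes "F \<in> L2 M" "f \<in> F"
  shows "f \<in> square_integrable M \<and> F = l2_class M f"
proof -
  obtain g where g: "g \<in> square_integrable M" "F = l2_class M g"
    using assms(1) unfolding L2_def l2_class_def by (rule quotientE)
  then have "f \<in> square_integrable M" "AE x in M. g x = f x"
    using assms(2) by (simp_all add: mem_l2_class)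
  then show ?thesis
    using g l2_class_eq[of g M f] by simp
qed

lemma L2_obtain:
  assumes "F \<in> L2 M"
  obtains f where "f \<in> square_integrable M" "F = l2_class M f"
  using assms unfolding L2_def l2_class_def by (rule quotientE)

lemma l2_class_in_L2_imp_square_integrable:
  assumes "l2_class M f \<in> L2 M"
  shows "f \<in> square_integrable M"
proof -
  have "l2_class M f \<noteq> {}"
    using L2_obtain[OF assms] l2_class_self by blast
  then show ?thesis by (auto simp: mem_l2_class)
qed

lemma l2_class_in_L2: "f \<in> square_integrable M \<Longrightarrow> l2_class M f \<in> L2 M"
  unfolding L2_def l2_class_def by (rule quotientI)

lemma l2_norm_class:
  assumes "f \<in> square_integrable M"
  shows "l2_norm M (l2_class M f) = sqrt (LINT x|M. (cmod (f x))\<^sup>2)"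
proof -
  have "l2_inner M (l2_class M f) (l2_class M f) = (LINT x|M. complex_of_real ((cmod (f x))\<^sup>2))"
    unfolding complex_norm_square l2_inner_class[OF assms assms] by (simp add: mult.commute)
  then show ?thesis
    unfolding l2_norm_def integral_complex_of_real by simp
qed

section \<open>The adjoint of a densely defined operator\<close>

text \<open>
  If \<open>h\<close> is orthogonal to \<open>g\<close>, then \<open>\<parallel>h\<parallel>\<^sup>2 \<le> \<parallel>h\<parallel>\<^sup>2 + \<parallel>g\<parallel>\<^sup>2 = \<parallel>h - g\<parallel>\<^sup>2\<close>. With \<open>g\<close> running through a
  dense set the right-hand side becomes arbitrarily small.
\<close>

lemma orthogonal_to_dense_imp_AE_zero:
  assumes dense: "l2_dense M D" and D: "D \<subseteq> L2 M"
    and h: "h \<in> square_integrable M"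
    and orth: "\<And>g. g \<in> square_integrable M \<Longrightarrow> l2_class M g \<in> D \<Longrightarrow> (LINT x|M. cnj (h x) * g x) = 0"
  shows "AE x in M. h x = 0"
proof -
  let ?N = "LINT x|M. (cmod (h x))\<^sup>2"
  have N_less: "?N < e\<^sup>2" if "e > 0" for e
  proof -
    obtain G where "G \<in> D" and G: "l2_norm M (l2_add M (l2_class M h) (l2_scale M (-1) G)) < e"
      using dense l2_class_in_L2[OF h] \<open>e > 0\<close> unfolding l2_dense_def by blast
    obtain g where g: "g \<in> square_integrable M" "G = l2_class M g"
      using L2_obtain D \<open>G \<in> D\<close> by blast
    have mg: "(\<lambda>x. -1 * g x) \<in> square_integrable M"
      by (rule square_integrable_scale[OF g(1)])
    have diff: "(\<lambda>x. h x + -1 * g x) \<in> square_integrable M"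
      by (rule square_integrable_add[OF h mg])
    have int: "integrable M (\<lambda>x. cnj (h x) * g x)"
      "integrable M (\<lambda>x. (cmod (h x))\<^sup>2)" "integrable M (\<lambda>x. (cmod (g x))\<^sup>2)"
      using integrable_square_integrable_mult[OF h g(1)] h g(1)
      by (auto simp: square_integrable_def)
    have cross: "(LINT x|M. Re (cnj (h x) * g x)) = 0"
      using orth[OF g(1)] g(2) \<open>G \<in> D\<close> integral_Re[OF int(1)] by simp
    have pointwise: "(cmod (h x + -1 * g x))\<^sup>2 =
        (cmod (h x))\<^sup>2 + (cmod (g x))\<^sup>2 - 2 * Re (cnj (h x) * g x)" for x
      unfolding cmod_power2 by (simp add: power2_eq_square algebra_simps)
    have "?N \<le> ?N + (LINT x|M. (cmod (g x))\<^sup>2)"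
      by (simp add: integral_nonneg_AE)
    also have "\<dots> = (LINT x|M. (cmod (h x))\<^sup>2 + (cmod (g x))\<^sup>2 - 2 * Re (cnj (h x) * g x))"
      using int integrable_Re[OF int(1)] cross by (simp del: times_complex.sel)
    also have "\<dots> = (l2_norm M (l2_class M (\<lambda>x. h x + -1 * g x)))\<^sup>2"
      unfolding l2_norm_class[OF diff] pointwise[symmetric] by (simp add: integral_nonneg_AE)
    also have "l2_class M (\<lambda>x. h x + -1 * g x) = l2_add M (l2_class M h) (l2_scale M (-1) G)"
      unfolding g(2) l2_scale_class[OF g(1)] l2_add_class[OF h mg] ..
    also have "(l2_norm M \<dots>)\<^sup>2 < e\<^sup>2"
    proof (rule power_strict_mono[OF G])
      show "0 \<le> l2_norm M (l2_add M (l2_class M h) (l2_scale M (-1) G))"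
        unfolding g(2) l2_scale_class[OF g(1)] l2_add_class[OF h mg] l2_norm_class[OF diff]
        by (simp add: integral_nonneg_AE)
    qed simp
    finally show ?thesis .
  qed
  have "?N \<le> 0"
  proof (rule ccontr)
    assume "\<not> ?N \<le> 0"
    then show False using N_less[of "sqrt ?N"] by simp
  qed
  then have "?N = 0"
    by (simp add: integral_nonneg_AE order_antisym)
  moreover have "integrable M (\<lambda>x. (cmod (h x))\<^sup>2)"
    using h by (simp add: square_integrable_def)
  ultimately have "AE x in M. (cmod (h x))\<^sup>2 = 0"
    using integral_nonneg_eq_0_iff_AE[of M "\<lambda>x. (cmod (h x))\<^sup>2"] by simp
  then show ?thesis by simp
qed

lemma dense_inner_eq_imp_AE_eq:
  assumes "l2_dense M D" "D \<subseteq> L2 M"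
    and h: "h1 \<in> square_integrable M" "h2 \<in> square_integrable M"
    and eq: "\<forall>G\<in>D. l2_inner M (l2_class M h1) G = l2_inner M (l2_class M h2) G"
  shows "AE x in M. h1 x = h2 x"
proof -
  have "AE x in M. h1 x + -1 * h2 x = 0"
  proof (rule orthogonal_to_dense_imp_AE_zero[OF assms(1,2)])
    show "(\<lambda>x. h1 x + -1 * h2 x) \<in> square_integrable M"
      using h by (intro square_integrable_add square_integrable_scale)
    fix g assume g: "g \<in> square_integrable M" "l2_class M g \<in> D"
    have "(LINT x|M. cnj (h1 x) * g x) = (LINT x|M. cnj (h2 x) * g x)"
      using eq g h by (simp add: l2_inner_class flip: l2_inner_class)
    moreover have "integrable M (\<lambda>x. cnj (h1 x) * g x)" "integrable M (\<lambda>x. cnj (h2 x) * g x)"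
      using h g(1) by (simp_all add: integrable_square_integrable_mult)
    ultimately show "(LINT x|M. cnj (h1 x + -1 * h2 x) * g x) = 0"
      by (simp add: left_diff_distrib)
  qed
  then show ?thesis by simp
qed

text \<open>
  Membership in \<open>adjoint_domain\<close> supplies an image vector and density makes it unique, so the
  description by \<open>THE\<close> picks it out; all later use of the adjoint goes through these two facts.
\<close>

lemma adjoint_op_properties:
  assumes dense: "l2_dense M D" and D: "D \<subseteq> L2 M" and F: "F \<in> adjoint_domain M D K"
  shows "adjoint_op M D K F \<in> L2 M"
    and "G \<in> D \<Longrightarrow> l2_inner M F (K G) = l2_inner M (adjoint_op M D K F) G"
proof -
  let ?P = "\<lambda>H. H \<in> L2 M \<and> (\<forall>G\<in>D. l2_inner M F (K G) = l2_inner M H G)"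
  have unique: "H1 = H2" if P: "?P H1" "?P H2" for H1 H2
  proof -
    obtain h1 h2 where h: "h1 \<in> square_integrable M" "H1 = l2_class M h1"
      "h2 \<in> square_integrable M" "H2 = l2_class M h2"
      using P L2_obtain by metis
    have "\<forall>G\<in>D. l2_inner M (l2_class M h1) G = l2_inner M (l2_class M h2) G"
      using P h(2,4) by metis
    then have "AE x in M. h1 x = h2 x"
      by (rule dense_inner_eq_imp_AE_eq[OF dense D h(1,3)])
    then show ?thesis
      using h by (simp add: l2_class_eq)
  qed
  obtain H where H: "?P H"
    using F unfolding adjoint_domain_def by blast
  have "?P (adjoint_op M D K F)"
    unfolding adjoint_op_def by (rule theI[of ?P, OF H unique[OF _ H]])
  then show "adjoint_op M D K F \<in> L2 M"
    and "G \<in> D \<Longrightarrow> l2_inner M F (K G) = l2_inner M (adjoint_op M D K F) G"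
    by blast+
qed

section \<open>Weighted averages\<close>

text \<open>
  Otherwise \<open>u - c \<phi> > 0\<close> everywhere. Then \<open>(u - c \<phi>) p\<close>, being nonnegative with integral zero, is
  zero almost everywhere, and dividing by the positive factor shows the same for \<open>p\<close>.
\<close>

lemma exists_le_weighted_average:
  fixes u \<phi> p :: "'a \<Rightarrow> real"
  assumes p: "AE x in M. 0 \<le> p x" "\<not> (AE x in M. p x = 0)"
    and int: "integrable M (\<lambda>x. u x * p x)" "integrable M (\<lambda>x. \<phi> x * p x)"
    and avg: "(LINT x|M. u x * p x) = c * (LINT x|M. \<phi> x * p x)"
  shows "\<exists>x\<in>space M. u x \<le> c * \<phi> x"
proof (rule ccontr)
  assume "\<not> ?thesis"
  then have pos: "u x - c * \<phi> x > 0" if "x \<in> space M" for x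
    using that by force
  let ?w = "\<lambda>x. u x * p x - c * (\<phi> x * p x)"
  have w: "?w x = (u x - c * \<phi> x) * p x" for x
    by (simp add: algebra_simps)
  have "AE x in M. 0 \<le> ?w x"
    using p(1) AE_space
  proof eventually_elim
    case (elim x)
    then show ?case unfolding w using pos[of x] by simp
  qed
  moreover have "integrable M ?w" "(LINT x|M. ?w x) = 0"
    using int avg by simp_all
  ultimately have "AE x in M. ?w x = 0"
    using integral_nonneg_eq_0_iff_AE[of M ?w] by simp
  then have "AE x in M. p x = 0"
    using AE_space
  proof eventually_elim
    case (elim x)
    then show ?case unfolding w using pos[of x] by simp
  qed
  with p(2) show False ..
qed

text \<open>The upper bound is the lower bound for \<open>- u\<close> and \<open>- c\<close>.\<close>

lemma weighted_average_between_INF_SUP: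
  fixes u \<phi> p :: "'a \<Rightarrow> real"
  assumes p: "AE x in M. 0 \<le> p x" "\<not> (AE x in M. p x = 0)"
    and pos: "\<And>x. x \<in> space M \<Longrightarrow> 0 < \<phi> x"
    and int: "integrable M (\<lambda>x. u x * p x)" "integrable M (\<lambda>x. \<phi> x * p x)"
    and avg: "(LINT x|M. u x * p x) = c * (LINT x|M. \<phi> x * p x)"
  shows "(INF x\<in>space M. ereal (u x / \<phi> x)) \<le> ereal c"
    and "ereal c \<le> (SUP x\<in>space M. ereal (u x / \<phi> x))"
proof -
  obtain x where x: "x \<in> space M" "u x \<le> c * \<phi> x"
    using exists_le_weighted_average[OF p int avg] by blast
  then have "u x / \<phi> x \<le> c"
    using pos[of x] by (simp add: divide_le_eq)
  then show "(INF x\<in>space M. ereal (u x / \<phi> x)) \<le> ereal c"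
    using x(1) by (intro INF_lower2[of x]) auto
  obtain y where y: "y \<in> space M" "- u y \<le> (- c) * \<phi> y"
    using exists_le_weighted_average[OF p, of "\<lambda>x. - u x" \<phi> "- c"] int avg by auto
  then have "c \<le> u y / \<phi> y"
    using pos[of y] by (simp add: le_divide_eq)
  then show "ereal c \<le> (SUP x\<in>space M. ereal (u x / \<phi> x))"
    using y(1) by (intro SUP_upper2[of y]) auto
qed

section \<open>Bounds for the eigenvalue\<close>

theorem theorem2:
  fixes X :: "'a topology" and \<mu> :: "'a measure"
    and D :: "('a \<Rightarrow> complex) set set"
    and K :: "('a \<Rightarrow> complex) set \<Rightarrow> ('a \<Rightarrow> complex) set"
    and k0 :: complex
    and \<psi> \<eta> :: "'a \<Rightarrow> complex" and \<phi> :: "'a \<Rightarrow> real"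
  assumes "locally_compact_space X" and "radon_measure X \<mu>"
    and "l2_operator \<mu> D K" and "l2_dense \<mu> D"
    and "l2_eigenvector \<mu> D K k0 (l2_class \<mu> \<psi>)"
    and "AE q in \<mu>. \<psi> q \<in> \<real> \<and> 0 \<le> Re (\<psi> q)"
    and "l2_class \<mu> (\<lambda>q. complex_of_real (\<phi> q)) \<in> adjoint_domain \<mu> D K"
    and "\<forall>q\<in>topspace X. 0 < \<phi> q"
    and "\<eta> \<in> adjoint_op \<mu> D K (l2_class \<mu> (\<lambda>q. complex_of_real (\<phi> q)))"
  shows "(INF q\<in>topspace X. ereal (Re (\<eta> q) / \<phi> q)) \<le> ereal (Re k0)
       \<and> ereal (Re k0) \<le> (SUP q\<in>topspace X. ereal (Re (\<eta> q) / \<phi> q))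
       \<and> (INF q\<in>topspace X. ereal (- (Im (\<eta> q) / \<phi> q))) \<le> ereal (Im k0)
       \<and> ereal (Im k0) \<le> (SUP q\<in>topspace X. ereal (- (Im (\<eta> q) / \<phi> q)))"
proof -
  let ?f = "\<lambda>q. complex_of_real (\<phi> q)"
  let ?p = "\<lambda>q. Re (\<psi> q)"
  have D: "D \<subseteq> L2 \<mu>"
    using assms(3) by (simp add: l2_operator_def)
  have space: "space \<mu> = topspace X"
    using assms(2) by (simp add: radon_measure_def)
  have ev: "l2_class \<mu> \<psi> \<in> D" "l2_class \<mu> \<psi> \<noteq> l2_zero \<mu>"
    "K (l2_class \<mu> \<psi>) = l2_scale \<mu> k0 (l2_class \<mu> \<psi>)"
    using assms(5) by (simp_all add: l2_eigenvector_def)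
  have \<psi>: "\<psi> \<in> square_integrable \<mu>"
    using ev(1) D by (blast intro: l2_class_in_L2_imp_square_integrable)
  have f: "?f \<in> square_integrable \<mu>"
    using assms(7) by (auto simp: adjoint_domain_def intro: l2_class_in_L2_imp_square_integrable)
  note adj = adjoint_op_properties[OF assms(4) D assms(7)]
  have \<eta>: "\<eta> \<in> square_integrable \<mu>" "adjoint_op \<mu> D K (l2_class \<mu> ?f) = l2_class \<mu> \<eta>"
    using L2_eq_class[OF adj(1) assms(9)] by simp_all
  have int: "integrable \<mu> (\<lambda>q. cnj (\<eta> q) * \<psi> q)" "integrable \<mu> (\<lambda>q. ?f q * \<psi> q)"
    using integrable_square_integrable_mult[OF \<eta>(1) \<psi>] integrable_square_integrable_mult[OF f \<psi>]
    by simp_all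
  have key: "(LINT q|\<mu>. cnj (\<eta> q) * \<psi> q) = k0 * (LINT q|\<mu>. ?f q * \<psi> q)"
  proof -
    have "(LINT q|\<mu>. cnj (\<eta> q) * \<psi> q) = l2_inner \<mu> (l2_class \<mu> ?f) (K (l2_class \<mu> \<psi>))"
      using adj(2)[OF ev(1)] \<eta> \<psi> by (simp add: l2_inner_class)
    also have "\<dots> = (LINT q|\<mu>. k0 * (?f q * \<psi> q))"
      unfolding ev(3) l2_scale_class[OF \<psi>]
      using f \<psi> by (simp add: l2_inner_class square_integrable_scale mult.left_commute)
    finally show ?thesis by simp
  qed
  \<comment> \<open>Only almost everywhere is \<open>\<psi>\<close> real, so its real part serves as the weight.\<close>
  have real: "AE q in \<mu>. \<psi> q = complex_of_real (?p q)"
    using assms(6) by eventually_elim (simp add: complex_is_Real_iff complex_eq_iff)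
  have p: "AE q in \<mu>. 0 \<le> ?p q"
    using assms(6) by eventually_elim simp
  have nonzero: "\<not> (AE q in \<mu>. ?p q = 0)"
  proof
    assume "AE q in \<mu>. ?p q = 0"
    with real have "AE q in \<mu>. \<psi> q = 0"
      by eventually_elim simp
    then have "l2_class \<mu> \<psi> = l2_zero \<mu>"
      using \<psi> by (simp add: l2_zero_def l2_class_eq square_integrable_def)
    with ev(2) show False ..
  qed
  have [measurable]: "\<psi> \<in> borel_measurable \<mu>" "\<eta> \<in> borel_measurable \<mu>"
    using \<psi> \<eta>(1) by (simp_all add: square_integrable_def)
  have f_p: "integrable \<mu> (\<lambda>q. \<phi> q * ?p q)"
    "Re (LINT q|\<mu>. ?f q * \<psi> q) = (LINT q|\<mu>. \<phi> q * ?p q)"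
    using integrable_Re[OF int(2)] integral_Re[OF int(2)] by simp_all
  have "Im (LINT q|\<mu>. ?f q * \<psi> q) = (LINT q|\<mu>. \<phi> q * Im (\<psi> q))"
    using integral_Im[OF int(2)] by simp
  also have "\<dots> = 0"
  proof (rule integral_eq_zero_AE)
    show "AE q in \<mu>. \<phi> q * Im (\<psi> q) = 0"
      using real by eventually_elim (simp add: complex_eq_iff)
  qed
  finally have Im_f_p: "Im (LINT q|\<mu>. ?f q * \<psi> q) = 0" .
  have Re_AE: "AE q in \<mu>. Re (cnj (\<eta> q) * \<psi> q) = Re (\<eta> q) * ?p q"
    using real by eventually_elim (simp add: complex_eq_iff)
  have Im_AE: "AE q in \<mu>. Im (cnj (\<eta> q) * \<psi> q) = - Im (\<eta> q) * ?p q"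
    using real by eventually_elim (simp add: complex_eq_iff)
  have Re_int: "integrable \<mu> (\<lambda>q. Re (\<eta> q) * ?p q)"
    by (rule integrable_cong_AE_imp[OF integrable_Re[OF int(1)]])
      (measurable, use Re_AE in eventually_elim, simp)
  have Im_int: "integrable \<mu> (\<lambda>q. - Im (\<eta> q) * ?p q)"
    by (rule integrable_cong_AE_imp[OF integrable_Im[OF int(1)]])
      (measurable, use Im_AE in eventually_elim, simp)
  have "(LINT q|\<mu>. Re (\<eta> q) * ?p q) = Re (LINT q|\<mu>. cnj (\<eta> q) * \<psi> q)"
    unfolding integral_Re[OF int(1), symmetric]
    by (rule integral_cong_AE[symmetric, OF _ _ Re_AE])
      (use Re_int integrable_Re[OF int(1)] in \<open>simp_all only: borel_measurable_integrable\<close>)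
  then have Re_avg: "(LINT q|\<mu>. Re (\<eta> q) * ?p q) = Re k0 * (LINT q|\<mu>. \<phi> q * ?p q)"
    using key f_p(2) Im_f_p by simp
  have "(LINT q|\<mu>. - Im (\<eta> q) * ?p q) = Im (LINT q|\<mu>. cnj (\<eta> q) * \<psi> q)"
    unfolding integral_Im[OF int(1), symmetric]
    by (rule integral_cong_AE[symmetric, OF _ _ Im_AE])
      (use Im_int integrable_Im[OF int(1)] in \<open>simp_all only: borel_measurable_integrable\<close>)
  then have Im_avg: "(LINT q|\<mu>. - Im (\<eta> q) * ?p q) = Im k0 * (LINT q|\<mu>. \<phi> q * ?p q)"
    using key f_p(2) Im_f_p by simp
  have pos: "0 < \<phi> q" if "q \<in> space \<mu>" for q
    using assms(8) that space by simp
  note weighted_average_between_INF_SUP[OF p nonzero pos Re_int f_p(1) Re_avg]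
    weighted_average_between_INF_SUP[OF p nonzero pos Im_int f_p(1) Im_avg]
  then show ?thesis
    by (simp add: space)
qed

end
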